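(* A topological space $X$ is a CCC space if and only if $X$ has a compact subspace that intersects every connected component of $X$.
   Context: A topological space $X$ is a CCC space if it is a continuous image of a product of a compact space and a connected space, i.e. there exist a compact space $K$, a connected space $C$ and a continuous surjection $f:K\times C\to X$. No separation axioms are assumed; compact means that every open cover has a finite subcover. *)

theory Defs
  imports "HOL-Analysis.Analysis"
begin

definition ccc_presentation ::
  "'k topology \<Rightarrow> 'c topology \<Rightarrow> ('k \<times> 'c \<Rightarrow> 'a) \<Rightarrow> 'a topology \<Rightarrow> bool" where
  "ccc_presentation K C f X \<longleftrightarrow>
     compact_space K \<and> connected_space C \<and>
     continuous_map (prod_topology K C) X f \<and>
     f ` topspace (prod_topology K C) = topspace X"

text \<open>
  A CCC space is one that has a presentation by some compact \<open>K\<close> and some connected \<open>C\<close>, of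
  whatever underlying sets. HOL cannot quantify existentially over the types carrying \<open>K\<close> and
  \<open>C\<close>, so the definition fixes two types built from the type of points of \<open>X\<close>. That this loses
  nothing, i.e. that a presentation over arbitrary types \<open>'k\<close> and \<open>'c\<close> already makes \<open>X\<close> a CCC
  space in this sense, is not assumed anywhere: it is a claim to be proved along with any
  statement about all CCC spaces.
\<close>

definition ccc_space :: "'a topology \<Rightarrow> bool" where
  "ccc_space X \<longleftrightarrow>
     (\<exists>(K :: ('a + 'a set) topology) (C :: 'a set topology) f. ccc_presentation K C f X)"

end

theory Submission
  imports Defs
begin

text \<open>
  For a presentation \<open>f : K \<times> C \<rightarrow> X\<close> the compact set is \<open>f(K \<times> {c\<^sub>0})\<close>: every point of \<open>X\<close> lies on
  a connected slice \<open>f({k} \<times> C)\<close>, and the slice meets this set in \<open>f(k, c\<^sub>0)\<close>.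

  Conversely, let \<open>S\<close> be compact and choose \<open>r Q \<in> S \<inter> Q\<close> in every component \<open>Q\<close>. One wants
  \<open>K\<close> to have a point for each \<open>Q\<close>, whose slice \<open>C \<rightarrow> X\<close> covers exactly \<open>Q\<close>. Two devices make
  these slices fit together continuously over a compact \<open>K\<close>.

  \<^item> \<open>K\<close> is \<open>S\<close> together with one isolated point per component, where the point of \<open>Q\<close> is attached
    to \<open>r Q\<close> as in the Alexandroff duplicate: a neighbourhood of \<open>s \<in> S\<close> contains almost all
    attached points that lie over a neighbourhood of \<open>s\<close>. Compactness is inherited from \<open>S\<close>.
  \<^item> \<open>C\<close> is the wedge of all components, joined at their base points \<open>r Q\<close>, with the fine (quotient)
    topology. Since no separation is asked for, the base points need not be identified; it is
    enough to make them topologically indistinguishable.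

  The slice over \<open>s \<in> S\<close> is constant with value \<open>s\<close>, and the slice over \<open>Q\<close> is the retraction of
  the wedge to its summand \<open>Q\<close>, which sends all other summands to \<open>r Q\<close>. The delicate point is
  continuity at \<open>(s, c)\<close> with \<open>c \<in> Q\<^sub>0\<close>. Given an open \<open>U\<close> containing \<open>s\<close>, take the
  part of \<open>K\<close> that lies over \<open>U\<close>, without the point of \<open>Q\<^sub>0\<close>, and delete from the wedge all
  points outside \<open>U\<close> in the summands \<open>Q \<noteq> Q\<^sub>0\<close> with \<open>r Q \<in> U\<close>. The fine topology
  permits infinitely many such conditions at once, and leaving out the one point of \<open>Q\<^sub>0\<close> is
  among the finitely many exceptions that a neighbourhood of \<open>s\<close> in \<open>K\<close> may make.

  The first half works for presentations over arbitrary types, and the second produces one over the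
  types in the definition of \<open>ccc_space\<close>, so together they show that the choice of these types
  loses nothing.
\<close>

section \<open>From a presentation to a compact set\<close>

lemma ccc_presentation_imp_compact_transversal:
  assumes "ccc_presentation K C f X"
  shows "\<exists>S. compactin X S \<and> (\<forall>Q \<in> connected_components_of X. S \<inter> Q \<noteq> {})"
proof (cases "topspace C = {}")
  case True
  then have "topspace X = {}"
    using assms by (auto simp: ccc_presentation_def)
  then show ?thesis
    by (intro exI[of _ "{}"]) (simp add: connected_components_of_def)
next
  case False
  then obtain c0 where c0: "c0 \<in> topspace C" by blast
  have K: "compact_space K" and C: "connected_space C"
    and f: "continuous_map (prod_topology K C) X f"
    and onto: "f ` (topspace K \<times> topspace C) = topspace X"
    using assms by (auto simp: ccc_presentation_def)
  let ?S = "(\<lambda>k. f (k, c0)) ` topspace K"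
  have "continuous_map K X (f \<circ> (\<lambda>k. (k, c0)))"
    using c0 by (intro continuous_map_compose[OF _ f]) (simp add: continuous_map_pairedI)
  then have "compactin X ?S"
    using image_compactin K by (fastforce simp: compact_space_def o_def)
  moreover have "?S \<inter> Q \<noteq> {}" if Q: "Q \<in> connected_components_of X" for Q
  proof -
    obtain x where x: "x \<in> Q" "x \<in> topspace X"
      using Q nonempty_connected_components_of connected_components_of_subset by fastforce
    then obtain k c where k: "k \<in> topspace K" and c: "c \<in> topspace C" and fx: "f (k, c) = x"
      using onto by force
    have "continuous_map C X (f \<circ> Pair k)"
      using k by (intro continuous_map_compose[OF _ f]) (simp add: continuous_map_pairedI)
    then have conn: "connectedin X ((f \<circ> Pair k) ` topspace C)"
      using C connectedin_continuous_map_image connectedin_topspace by blast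
    moreover have "x \<in> (f \<circ> Pair k) ` topspace C"
      using c fx by force
    ultimately have "(f \<circ> Pair k) ` topspace C \<subseteq> Q"
      using x Q connected_components_of_maximal by (metis disjnt_iff)
    then show ?thesis
      using c0 k by auto
  qed
  ultimately show ?thesis by blast
qed


section \<open>Attaching isolated points to a compact set\<close>

text \<open>
  The set \<open>S\<close> with an isolated point for each \<open>i \<in> I\<close> attached at \<open>r i\<close>; the Alexandroff duplicate
  of \<open>X\<close> is the case \<open>S = I = topspace X\<close>, \<open>r = id\<close>.
\<close>

definition attach_isolated :: "'a topology \<Rightarrow> 'a set \<Rightarrow> 'i set \<Rightarrow> ('i \<Rightarrow> 'a) \<Rightarrow> ('a + 'i) topology" where
  "attach_isolated X S I r = topology (\<lambda>W. W \<subseteq> S <+> I \<and>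
     (\<forall>s. Inl s \<in> W \<longrightarrow> (\<exists>U. openin X U \<and> s \<in> U \<and> Inl ` (S \<inter> U) \<subseteq> W \<and>
        finite {i \<in> I. r i \<in> U \<and> Inr i \<notin> W})))"

lemma openin_attach_isolated:
  "openin (attach_isolated X S I r) W \<longleftrightarrow> W \<subseteq> S <+> I \<and>
     (\<forall>s. Inl s \<in> W \<longrightarrow> (\<exists>U. openin X U \<and> s \<in> U \<and> Inl ` (S \<inter> U) \<subseteq> W \<and>
        finite {i \<in> I. r i \<in> U \<and> Inr i \<notin> W}))"
  (is "_ \<longleftrightarrow> ?open W")
proof -
  have "istopology ?open"
    unfolding istopology_def
  proof (intro conjI allI impI)
    fix V W assume V: "?open V" and W: "?open W"
    show "V \<inter> W \<subseteq> S <+> I" using V by blast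
    fix s assume "Inl s \<in> V \<inter> W"
    then have s: "Inl s \<in> V" "Inl s \<in> W" by blast+
    obtain A where A: "openin X A" "s \<in> A" "Inl ` (S \<inter> A) \<subseteq> V"
        "finite {i \<in> I. r i \<in> A \<and> Inr i \<notin> V}"
      using V s(1) by meson
    obtain B where B: "openin X B" "s \<in> B" "Inl ` (S \<inter> B) \<subseteq> W"
        "finite {i \<in> I. r i \<in> B \<and> Inr i \<notin> W}"
      using W s(2) by meson
    have "finite {i \<in> I. r i \<in> A \<inter> B \<and> Inr i \<notin> V \<inter> W}"
      by (rule finite_subset[OF _ finite_UnI[OF A(4) B(4)]]) auto
    then show "\<exists>U. openin X U \<and> s \<in> U \<and> Inl ` (S \<inter> U) \<subseteq> V \<inter> W \<and>
        finite {i \<in> I. r i \<in> U \<and> Inr i \<notin> V \<inter> W}"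
      using A B by (intro exI[of _ "A \<inter> B"]) auto
  next
    fix \<W> assume \<W>: "\<forall>W\<in>\<W>. ?open W"
    then show "\<Union>\<W> \<subseteq> S <+> I" by blast
    fix s assume "Inl s \<in> \<Union>\<W>"
    then obtain W where W: "W \<in> \<W>" "Inl s \<in> W" by blast
    then obtain U where U: "openin X U" "s \<in> U" "Inl ` (S \<inter> U) \<subseteq> W"
        "finite {i \<in> I. r i \<in> U \<and> Inr i \<notin> W}"
      using \<W> by meson
    have "finite {i \<in> I. r i \<in> U \<and> Inr i \<notin> \<Union>\<W>}"
      by (rule finite_subset[OF _ U(4)]) (use W in auto)
    then show "\<exists>U. openin X U \<and> s \<in> U \<and> Inl ` (S \<inter> U) \<subseteq> \<Union>\<W> \<and>
        finite {i \<in> I. r i \<in> U \<and> Inr i \<notin> \<Union>\<W>}"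
      using U W by (intro exI[of _ U]) auto
  qed
  then show ?thesis
    by (simp add: attach_isolated_def topology_inverse')
qed

lemma topspace_attach_isolated:
  assumes "S \<subseteq> topspace X"
  shows "topspace (attach_isolated X S I r) = S <+> I"
proof
  have "openin (attach_isolated X S I r) (S <+> I)"
    unfolding openin_attach_isolated
  proof (intro conjI allI impI)
    fix s assume "Inl s \<in> S <+> I"
    moreover have "finite {i \<in> I. r i \<in> topspace X \<and> Inr i \<notin> S <+> I}"
      by (rule finite_subset[of _ "{}"]) auto
    ultimately show "\<exists>U. openin X U \<and> s \<in> U \<and> Inl ` (S \<inter> U) \<subseteq> S <+> I \<and>
        finite {i \<in> I. r i \<in> U \<and> Inr i \<notin> S <+> I}"
      using assms by (intro exI[of _ "topspace X"] conjI) auto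
  qed simp
  then show "S <+> I \<subseteq> topspace (attach_isolated X S I r)"
    by (rule openin_subset)
next
  show "topspace (attach_isolated X S I r) \<subseteq> S <+> I"
    using openin_topspace[of "attach_isolated X S I r"] unfolding openin_attach_isolated
    by (rule conjunct1)
qed

text \<open>
  Finitely many open sets of a cover contain \<open>S\<close> and even almost all the points attached over a
  neighbourhood of \<open>S\<close>. Since all points are attached at points of \<open>S\<close>, only finitely many remain.
\<close>

lemma compact_space_attach_isolated:
  assumes S: "compactin X S" and r: "r ` I \<subseteq> S"
  shows "compact_space (attach_isolated X S I r)"
  unfolding compact_space_alt
proof (intro allI impI, elim conjE)
  have top: "topspace (attach_isolated X S I r) = S <+> I"
    using S by (simp add: compactin_subset_topspace topspace_attach_isolated)
  fix \<W> assume open_\<W>: "\<forall>W\<in>\<W>. openin (attach_isolated X S I r) W"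
    and "topspace (attach_isolated X S I r) \<subseteq> \<Union>\<W>"
  then have cover: "S <+> I \<subseteq> \<Union>\<W>" by (simp add: top)
  define good where "good s U W \<longleftrightarrow> W \<in> \<W> \<and> openin X U \<and> s \<in> U \<and> Inl ` (S \<inter> U) \<subseteq> W \<and>
      finite {i \<in> I. r i \<in> U \<and> Inr i \<notin> W}" for s U W
  have "\<exists>U W. good s U W" if "s \<in> S" for s
  proof -
    obtain W where "W \<in> \<W>" "Inl s \<in> W"
      using \<open>s \<in> S\<close> cover by (metis InlI UnionE subsetD)
    then show ?thesis
      using open_\<W> unfolding openin_attach_isolated good_def by meson
  qed
  then obtain U W where "\<And>s. s \<in> S \<Longrightarrow> good s (U s) (W s)"
    by metis
  then have UW: "\<And>s. s \<in> S \<Longrightarrow> W s \<in> \<W> \<and> openin X (U s) \<and> s \<in> U s \<and>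
      Inl ` (S \<inter> U s) \<subseteq> W s \<and> finite {i \<in> I. r i \<in> U s \<and> Inr i \<notin> W s}"
    by (simp add: good_def)
  have "(\<forall>V\<in>U ` S. openin X V) \<and> S \<subseteq> \<Union>(U ` S)"
    using UW by auto
  then obtain \<F> where "finite \<F>" "\<F> \<subseteq> U ` S" "S \<subseteq> \<Union>\<F>"
    using S unfolding compactin_def by meson
  then obtain T where T: "finite T" "T \<subseteq> S" "S \<subseteq> \<Union>(U ` T)"
    by (metis finite_subset_image)
  define J where "J = (\<Union>s\<in>T. {i \<in> I. r i \<in> U s \<and> Inr i \<notin> W s})"
  have "finite J"
    unfolding J_def using T UW by blast
  have "\<forall>i\<in>I. \<exists>V\<in>\<W>. Inr i \<in> V"
    using cover by blast
  then obtain V where V: "\<And>i. i \<in> I \<Longrightarrow> V i \<in> \<W> \<and> Inr i \<in> V i"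
    by metis
  have "J \<subseteq> I" by (auto simp: J_def)
  have "S <+> I \<subseteq> \<Union>(W ` T \<union> V ` J)"
  proof
    fix x assume "x \<in> S <+> I"
    then show "x \<in> \<Union>(W ` T \<union> V ` J)"
    proof (rule PlusE)
      fix s assume s: "s \<in> S" "x = Inl s"
      then obtain t where "t \<in> T" "s \<in> U t" using T by blast
      then have "Inl s \<in> W t" using UW[of t] T s by blast
      then show ?thesis using s \<open>t \<in> T\<close> by blast
    next
      fix i assume i: "i \<in> I" "x = Inr i"
      then obtain t where "t \<in> T" "r i \<in> U t" using T r by blast
      then have "Inr i \<in> W t \<or> i \<in> J"
        using i by (auto simp: J_def)
      then show ?thesis
        using i V \<open>t \<in> T\<close> by blast
    qed
  qed
  moreover have "W ` T \<union> V ` J \<subseteq> \<W>"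
    using UW T V \<open>J \<subseteq> I\<close> by blast
  ultimately show "\<exists>\<F>. finite \<F> \<and> \<F> \<subseteq> \<W> \<and> topspace (attach_isolated X S I r) \<subseteq> \<Union>\<F>"
    using T(1) \<open>finite J\<close> by (intro exI[of _ "W ` T \<union> V ` J"]) (simp add: top)
qed


section \<open>The wedge of the components\<close>

text \<open>
  The disjoint sum of the components of \<open>X\<close>, on the points of \<open>X\<close> itself, with the points of \<open>R\<close>
  made indistinguishable instead of being identified.
\<close>

definition component_wedge :: "'a topology \<Rightarrow> 'a set \<Rightarrow> 'a topology" where
  "component_wedge X R = topology (\<lambda>V. V \<subseteq> topspace X \<and>
     (\<forall>Q\<in>connected_components_of X. openin (subtopology X Q) (V \<inter> Q)) \<and>
     (R \<subseteq> V \<or> R \<inter> V = {}))"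

lemma openin_component_wedge:
  "openin (component_wedge X R) V \<longleftrightarrow> V \<subseteq> topspace X \<and>
     (\<forall>Q\<in>connected_components_of X. openin (subtopology X Q) (V \<inter> Q)) \<and>
     (R \<subseteq> V \<or> R \<inter> V = {})"
  (is "_ \<longleftrightarrow> ?open V")
proof -
  have "istopology ?open"
    unfolding istopology_def
  proof (intro conjI allI impI ballI)
    fix V W Q assume "?open V" "?open W" "Q \<in> connected_components_of X"
    then have "openin (subtopology X Q) ((V \<inter> Q) \<inter> (W \<inter> Q))" by blast
    then show "openin (subtopology X Q) (V \<inter> W \<inter> Q)"
      by (metis inf_assoc inf_commute inf_left_idem)
  next
    fix \<V> Q assume \<V>: "\<forall>V\<in>\<V>. ?open V" and Q: "Q \<in> connected_components_of X"
    have "openin (subtopology X Q) (\<Union>V\<in>\<V>. V \<inter> Q)"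
      using \<V> Q by blast
    then show "openin (subtopology X Q) (\<Union>\<V> \<inter> Q)"
      by (simp only: Int_Union2)
  qed blast+
  then show ?thesis
    by (simp add: component_wedge_def topology_inverse')
qed

lemma topspace_component_wedge:
  assumes "R \<subseteq> topspace X"
  shows "topspace (component_wedge X R) = topspace X"
proof
  have "topspace X \<inter> Q = topspace (subtopology X Q)" for Q
    by simp
  then have "openin (component_wedge X R) (topspace X)"
    unfolding openin_component_wedge using assms by (metis order_refl openin_topspace)
  then show "topspace X \<subseteq> topspace (component_wedge X R)"
    by (rule openin_subset)
qed (metis openin_component_wedge openin_topspace)

text \<open>
  A clopen set contains or misses each component, and contains or misses all the base points, so
  any one component decides for all the others.
\<close>

lemma connected_space_component_wedge:
  assumes R: "R \<subseteq> topspace X"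
    and meets: "\<And>Q. Q \<in> connected_components_of X \<Longrightarrow> R \<inter> Q \<noteq> {}"
  shows "connected_space (component_wedge X R)"
  unfolding connected_space_def
proof (intro notI, elim exE conjE)
  fix A B
  assume A: "openin (component_wedge X R) A" and B: "openin (component_wedge X R) B"
    and cover: "topspace (component_wedge X R) \<subseteq> A \<union> B" and disj: "A \<inter> B = {}"
    and ne: "A \<noteq> {}" "B \<noteq> {}"
  have sub: "Q \<subseteq> A \<or> Q \<subseteq> B" if Q: "Q \<in> connected_components_of X" for Q
  proof -
    have "connected_space (subtopology X Q)"
      using Q connectedin_connected_components_of connectedin_def by blast
    moreover have "openin (subtopology X Q) (A \<inter> Q)" "openin (subtopology X Q) (B \<inter> Q)"
      using A B Q unfolding openin_component_wedge by blast+
    moreover have "topspace (subtopology X Q) \<subseteq> (A \<inter> Q) \<union> (B \<inter> Q)"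
      using cover R by (auto simp: topspace_component_wedge)
    moreover have "(A \<inter> Q) \<inter> (B \<inter> Q) = {}"
      using disj by blast
    ultimately have "A \<inter> Q = {} \<or> B \<inter> Q = {}"
      unfolding connected_space_def by meson
    moreover have "Q \<subseteq> A \<union> B"
      using connected_components_of_subset[OF Q] cover R by (simp add: topspace_component_wedge)
    ultimately show ?thesis by blast
  qed
  have base: "R \<subseteq> V"
    if V: "openin (component_wedge X R) V" "V = A \<or> V = B" "V \<noteq> {}" for V
  proof -
    obtain x where x: "x \<in> V" using V by blast
    then have "x \<in> \<Union>(connected_components_of X)"
      using V(1) unfolding openin_component_wedge Union_connected_components_of by blast
    then obtain Q where Q: "Q \<in> connected_components_of X" "x \<in> Q"
      by blast
    then have "Q \<subseteq> V" using sub disj V x by blast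
    then show ?thesis
      using V(1) meets[OF Q(1)] unfolding openin_component_wedge by blast
  qed
  have "R = {}" using base[OF A] base[OF B] ne disj by blast
  moreover have "\<Union>(connected_components_of X) \<noteq> {}"
    using ne A unfolding openin_component_wedge Union_connected_components_of by blast
  then obtain Q where "Q \<in> connected_components_of X"
    by blast
  ultimately show False using meets by blast
qed


section \<open>From a compact set to a presentation\<close>

definition slice_map :: "('a set \<Rightarrow> 'a) \<Rightarrow> ('a + 'a set) \<times> 'a \<Rightarrow> 'a" where
  "slice_map r = (\<lambda>(k, c). case k of Inl s \<Rightarrow> s | Inr Q \<Rightarrow> if c \<in> Q then c else r Q)"

lemma slice_map_simps [simp]:
  "slice_map r (Inl s, c) = s"
  "slice_map r (Inr Q, c) = (if c \<in> Q then c else r Q)"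
  by (simp_all add: slice_map_def)

text \<open>
  Over the isolated points this is the continuity of the retractions of the wedge. Near the constant
  slices, a product of the components in place of the wedge would fail: its neighbourhoods restrict
  only finitely many coordinates, whereas all the slices over a neighbourhood of \<open>s\<close> must be
  controlled at once.
\<close>

lemma continuous_map_slice_map:
  fixes X :: "'a topology" and r :: "'a set \<Rightarrow> 'a"
  defines "I \<equiv> connected_components_of X"
  assumes S: "S \<subseteq> topspace X" and r: "\<And>Q. Q \<in> I \<Longrightarrow> r Q \<in> S \<inter> Q"
  shows "continuous_map (prod_topology (attach_isolated X S I r) (component_wedge X (r ` I))) X
           (slice_map r)"
    (is "continuous_map (prod_topology ?K ?C) X _")
proof -
  have topK: "topspace ?K = S <+> I"
    by (rule topspace_attach_isolated[OF S])
  have R: "r ` I \<subseteq> topspace X" using r S by blast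
  have topC: "topspace ?C = topspace X"
    by (rule topspace_component_wedge[OF R])
  have same: "P = Q" if "P \<in> I" "Q \<in> I" "x \<in> P" "x \<in> Q" for P Q x
    using that connected_components_of_overlap unfolding I_def by fastforce
  have subX: "Q \<subseteq> topspace X" if "Q \<in> I" for Q
    using that connected_components_of_subset unfolding I_def by blast
  have open_all: "openin (subtopology X Q) Q" if "Q \<in> I" for Q
    using subX[OF that] by (metis openin_topspace topspace_subtopology_subset)
  have open_part: "openin (subtopology X Q) (U \<inter> Q)" if "openin X U" for U Q
    using that by (meson openin_subtopology)
  have "\<exists>N V. openin ?K N \<and> openin ?C V \<and> k \<in> N \<and> c \<in> V \<and>
      N \<times> V \<subseteq> {p \<in> topspace (prod_topology ?K ?C). slice_map r p \<in> U}"
    if U: "openin X U" and k: "k \<in> S <+> I" and c: "c \<in> topspace X"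
      and fU: "slice_map r (k, c) \<in> U" for U k c
    using k
  proof (rule PlusE)
    fix s assume s: "s \<in> S" "k = Inl s"
    obtain Q0 where Q0: "Q0 \<in> I" "c \<in> Q0"
      using c unfolding I_def Union_connected_components_of[of X, symmetric] by blast
    \<comment> \<open>The summand of \<open>c\<close> is left whole in \<open>V\<close>, at the price of leaving its point out of \<open>N\<close>.\<close>
    define N where "N = (S \<inter> U) <+> {Q \<in> I. r Q \<in> U \<and> Q \<noteq> Q0}"
    define V where "V = {x \<in> topspace X. \<forall>Q\<in>I. x \<in> Q \<and> Q \<noteq> Q0 \<and> r Q \<in> U \<longrightarrow> x \<in> U}"
    have "finite {i \<in> I. r i \<in> U \<and> Inr i \<notin> N}"
      by (rule finite_subset[of _ "{Q0}"]) (auto simp: N_def)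
    moreover have "N \<subseteq> S <+> I" "Inl ` (S \<inter> U) \<subseteq> N"
      by (auto simp: N_def)
    moreover have "t \<in> U" if "Inl t \<in> N" for t
      using that by (auto simp: N_def)
    ultimately have "openin ?K N"
      unfolding openin_attach_isolated using U by blast
    moreover have "openin ?C V"
      unfolding openin_component_wedge
    proof (intro conjI ballI)
      fix Q assume "Q \<in> connected_components_of X"
      then have Q: "Q \<in> I" by (simp add: I_def)
      show "openin (subtopology X Q) (V \<inter> Q)"
      proof (cases "Q \<noteq> Q0 \<and> r Q \<in> U")
        case True
        then have "V \<inter> Q = U \<inter> Q"
          using Q subX same by (fastforce simp: V_def)
        then show ?thesis using open_part[OF U] by simp
      next
        case False
        then have "V \<inter> Q = Q"
          using Q subX same by (fastforce simp: V_def)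
        then show ?thesis using open_all[OF Q] by simp
      qed
    next
      have "r Q \<in> V" if "Q \<in> I" for Q
        using that r[OF that] R same[OF that] by (auto simp: V_def)
      then show "r ` I \<subseteq> V \<or> r ` I \<inter> V = {}" by blast
    qed (auto simp: V_def)
    moreover have "k \<in> N" "c \<in> V"
      using s fU c Q0 same by (auto simp: N_def V_def)
    moreover have "slice_map r (l, x) \<in> U" if "l \<in> N" "x \<in> V" for l x
      using that(1) unfolding N_def
    proof (rule PlusE)
      fix Q assume "Q \<in> {Q \<in> I. r Q \<in> U \<and> Q \<noteq> Q0}" "l = Inr Q"
      then show ?thesis using \<open>x \<in> V\<close> by (auto simp: V_def)
    qed simp
    moreover have "N \<subseteq> S <+> I" "V \<subseteq> topspace X"
      by (auto simp: N_def V_def)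
    ultimately show ?thesis
      by (intro exI[of _ N] exI[of _ V]) (auto simp: topK topC)
  next
    fix Q assume Q: "Q \<in> I" "k = Inr Q"
    define V where "V = {x \<in> topspace X. slice_map r (k, x) \<in> U}"
    have "openin ?K {k}"
      using Q by (auto simp: openin_attach_isolated)
    moreover have "openin ?C V"
      unfolding openin_component_wedge
    proof (intro conjI ballI)
      fix P assume "P \<in> connected_components_of X"
      then have P: "P \<in> I" by (simp add: I_def)
      consider "P = Q" | "P \<noteq> Q" "r Q \<in> U" | "P \<noteq> Q" "r Q \<notin> U" by blast
      then show "openin (subtopology X P) (V \<inter> P)"
      proof cases
        case 1
        then have "V \<inter> P = U \<inter> P"
          using Q subX by (fastforce simp: V_def)
        then show ?thesis using open_part[OF U] by simp
      next
        case 2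
        then have "V \<inter> P = P"
          using Q P subX same by (fastforce simp: V_def)
        then show ?thesis using open_all[OF P] by simp
      next
        case 3
        then have "V \<inter> P = {}"
          using Q P same by (fastforce simp: V_def)
        then show ?thesis by simp
      qed
    next
      \<comment> \<open>The retraction to \<open>Q\<close> sends every base point to \<open>r Q\<close>.\<close>
      have "slice_map r (k, r P) = r Q" if "P \<in> I" for P
        using that Q r same by fastforce
      then show "r ` I \<subseteq> V \<or> r ` I \<inter> V = {}"
        using R by (cases "r Q \<in> U") (auto simp: V_def)
    qed (auto simp: V_def)
    moreover have "c \<in> V" "{k} \<times> V \<subseteq> {p \<in> topspace (prod_topology ?K ?C). slice_map r p \<in> U}"
      using c fU k by (auto simp: V_def topK topC)
    ultimately show ?thesis by blast
  qed
  then have "openin (prod_topology ?K ?C) {p \<in> topspace (prod_topology ?K ?C). slice_map r p \<in> U}"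
    if "openin X U" for U
    using that unfolding openin_prod_topology_alt by (simp add: topK topC)
  moreover have "slice_map r p \<in> topspace X" if "p \<in> topspace (prod_topology ?K ?C)" for p
    using that S R by (auto simp: topK topC)
  ultimately show ?thesis
    by (simp add: continuous_map) blast
qed

lemma compact_transversal_imp_ccc_presentation:
  fixes X :: "'a topology"
  assumes S: "compactin X S" and meets: "\<forall>Q \<in> connected_components_of X. S \<inter> Q \<noteq> {}"
  obtains K :: "('a + 'a set) topology" and C :: "'a topology" and f
  where "ccc_presentation K C f X"
proof -
  let ?I = "connected_components_of X"
  obtain r where r: "\<And>Q. Q \<in> ?I \<Longrightarrow> r Q \<in> S \<inter> Q"
    using meets bchoice[of ?I "\<lambda>Q x. x \<in> S \<inter> Q"] by blast
  have sub: "S \<subseteq> topspace X" by (rule compactin_subset_topspace[OF S])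
  have R: "r ` ?I \<subseteq> topspace X" using r sub by blast
  let ?K = "attach_isolated X S ?I r" and ?C = "component_wedge X (r ` ?I)"
  have "compact_space ?K"
    by (rule compact_space_attach_isolated[OF S]) (use r in blast)
  moreover have "connected_space ?C"
    by (rule connected_space_component_wedge[OF R]) (use r in blast)
  moreover have cont: "continuous_map (prod_topology ?K ?C) X (slice_map r)"
    by (rule continuous_map_slice_map[OF sub r])
  moreover have "topspace X \<subseteq> slice_map r ` topspace (prod_topology ?K ?C)"
  proof
    fix x assume x: "x \<in> topspace X"
    then obtain Q where "Q \<in> ?I" "x \<in> Q"
      unfolding Union_connected_components_of[of X, symmetric] by blast
    then show "x \<in> slice_map r ` topspace (prod_topology ?K ?C)"
      using x by (intro image_eqI[of _ _ "(Inr Q, x)"])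
        (auto simp: topspace_attach_isolated[OF sub] topspace_component_wedge[OF R])
  qed
  ultimately have "ccc_presentation ?K ?C (slice_map r) X"
    unfolding ccc_presentation_def using continuous_map_image_subset_topspace[OF cont] by blast
  then show thesis by (rule that)
qed

text \<open>
  The wedge has points of type \<open>'a\<close>, but \<open>ccc_space\<close> asks for a space of sets; the singletons
  carry a copy of the wedge.
\<close>

lemma ccc_presentation_singletons:
  fixes C :: "'c topology"
  assumes "ccc_presentation K C f X"
  obtains C' :: "'c set topology" and f' where "ccc_presentation K C' f' X"
proof -
  define C' where "C' = pullback_topology ((\<lambda>x. {x}) ` topspace C) the_elem C"
  have top: "topspace C' = (\<lambda>x. {x}) ` topspace C"
    by (auto simp: C'_def topspace_pullback_topology)
  have elem: "continuous_map C' C the_elem"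
    using continuous_map_pullback[OF continuous_map_id] unfolding C'_def by simp
  have "continuous_map C C' (\<lambda>x. {x})"
    unfolding C'_def by (rule continuous_map_pullback') (auto simp: o_def)
  then have "connectedin C' ((\<lambda>x. {x}) ` topspace C)"
    using assms connectedin_continuous_map_image connectedin_topspace
    unfolding ccc_presentation_def by blast
  then have "connected_space C'"
    by (metis top connectedin_topspace)
  moreover have "continuous_map (prod_topology K C') (prod_topology K C) (map_prod id the_elem)"
    using elem unfolding map_prod_def by (simp add: continuous_map_prod_top)
  then have "continuous_map (prod_topology K C') X (f \<circ> map_prod id the_elem)"
    using assms continuous_map_compose unfolding ccc_presentation_def by blast
  moreover have "map_prod id the_elem ` topspace (prod_topology K C') = topspace (prod_topology K C)"
    by (force simp: top)
  ultimately have "ccc_presentation K C' (f \<circ> map_prod id the_elem) X"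
    using assms unfolding ccc_presentation_def image_comp[symmetric] by simp
  then show thesis by (rule that)
qed

theorem theorem2:
  fixes X :: "'a topology"
  shows "(ccc_space X \<longleftrightarrow>
            (\<exists>S. compactin X S \<and> (\<forall>Q \<in> connected_components_of X. S \<inter> Q \<noteq> {})))
       \<and> (\<forall>(K :: 'k topology) (C :: 'c topology) f.
            ccc_presentation K C f X \<longrightarrow> ccc_space X)"
proof -
  have suff: "ccc_space X"
    if transversal: "\<exists>S. compactin X S \<and> (\<forall>Q \<in> connected_components_of X. S \<inter> Q \<noteq> {})"
  proof -
    obtain S where "compactin X S" "\<forall>Q \<in> connected_components_of X. S \<inter> Q \<noteq> {}"
      using transversal by blast
    then obtain K :: "('a + 'a set) topology" and C :: "'a topology" and f
      where "ccc_presentation K C f X"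
      by (rule compact_transversal_imp_ccc_presentation)
    then obtain C' :: "'a set topology" and f' where "ccc_presentation K C' f' X"
      by (rule ccc_presentation_singletons)
    then show ?thesis unfolding ccc_space_def by blast
  qed
  moreover have "\<exists>S. compactin X S \<and> (\<forall>Q \<in> connected_components_of X. S \<inter> Q \<noteq> {})"
    if "ccc_space X"
    using that unfolding ccc_space_def by (elim exE) (rule ccc_presentation_imp_compact_transversal)
  moreover have "ccc_space X" if "ccc_presentation K C f X"
    for K :: "'k topology" and C :: "'c topology" and f
    by (rule suff[OF ccc_presentation_imp_compact_transversal[OF that]])
  ultimately show ?thesis by (intro conjI allI impI iffI)
qed

end
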